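(* Let $l\ge 1$ and $k\ge 0$ be integers, and consider a stationary curvilinear element with non-singular map $x,y\in\mathbb{Q}^l(\xi,\eta)$. Consider on this element the flux reconstruction scheme $$\frac{\partial \widetilde{\boldsymbol Q}_h}{\partial t}+\frac{\partial\widetilde{\boldsymbol F}^{\rm loc}}{\partial\xi}+\frac{\partial\widetilde{\boldsymbol G}^{\rm loc}}{\partial\eta}+\widetilde{\boldsymbol\delta}^{\rm cor}=0,$$ with the solution, flux and correction field polynomial degrees listed in the context. Then the scheme numerically satisfies the geometric conservation law $$\frac{\partial}{\partial\xi}\begin{pmatrix}|J|\xi_x\\ |J|\xi_y\end{pmatrix}+\frac{\partial}{\partial\eta}\begin{pmatrix}|J|\eta_x\\ |J|\eta_y\end{pmatrix}=0$$ (in the sense defined in the context), no matter whether the metrics are calculated with the non-conservative or with the conservative formulas.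
   Context: **Spaces.** $P^a(\xi)$ denotes univariate polynomials of degree at most $a$; $\mathbb{Q}^a(\xi,\eta)=P^a(\xi)\otimes P^a(\eta)$ on the reference square $(\xi,\eta)\in[-1,1]^2$. **Equations and metrics.** The conservation law is $\partial_t\boldsymbol Q+\partial_x\boldsymbol F(\boldsymbol Q)+\partial_y\boldsymbol G(\boldsymbol Q)=0$ with $\boldsymbol Q,\boldsymbol F,\boldsymbol G\in\mathbb{R}^{N_v}$. In the reference domain (with $\tau\equiv t$) one sets $$\widetilde{\boldsymbol Q}=|J|\boldsymbol Q,\quad \widetilde{\boldsymbol F}=|J|\xi_x\boldsymbol F+|J|\xi_y\boldsymbol G,\quad \widetilde{\boldsymbol G}=|J|\eta_x\boldsymbol F+|J|\eta_y\boldsymbol G,$$ where $|J|=x_\xi y_\eta-x_\eta y_\xi\neq0$ is independent of time, and $|J|\xi_x=y_\eta$, $|J|\xi_y=-x_\eta$, $|J|\eta_x=-y_\xi$, $|J|\eta_y=x_\xi$. So $|J|\in\mathbb{Q}^{2l-1}$, $|J|\xi_x,|J|\xi_y\in P^l(\xi)\otimes P^{l-1}(\eta)$, $|J|\eta_x,|J|\eta_y\in P^{l-1}(\xi)\otimes P^l(\eta)$. "Non-conservative" calculation means using these expressions as products of coordinate derivatives; "conservative" calculation means using the algebraically equivalent expressions written as derivatives (curl form) of products of coordinates and their derivatives. In both cases the metrics are the exact polynomials, not approximated further. **Polynomial degrees.** Componentwise: $\boldsymbol Q_h\in\mathbb{Q}^k$; $\widetilde{\boldsymbol Q}_h=|J|\boldsymbol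 Q_h\in\mathbb{Q}^{k+2l-1}$; $\boldsymbol F^{\rm loc},\boldsymbol G^{\rm loc}\in\mathbb{Q}^{k+l}$; $\widetilde{\boldsymbol F}^{\rm loc},\widetilde{\boldsymbol F}^{\rm cor}\in P^{k+2l}(\xi)\otimes P^{k+2l-1}(\eta)$; $\widetilde{\boldsymbol G}^{\rm loc},\widetilde{\boldsymbol G}^{\rm cor}\in P^{k+2l-1}(\xi)\otimes P^{k+2l}(\eta)$; $\widetilde{\boldsymbol\delta}^{\rm cor}=|J|\boldsymbol\delta^{\rm cor}\in\mathbb{Q}^{k+2l-1}$ (with $\boldsymbol\delta^{\rm cor}$ nominally in $\mathbb{Q}^k$). **Scheme.** The solution points are the tensor grid of $k+2l$ Gauss--Legendre points in each direction, with tensor-product Lagrange basis $w_j^r\in\mathbb{Q}^{k+2l-1}(\xi,\eta)$. The superscript SP denotes values at solution points. The correction field is $\widetilde{\boldsymbol\delta}^{\rm cor}=\partial_\xi\widetilde{\boldsymbol F}^{\rm cor}+\partial_\eta\widetilde{\boldsymbol G}^{\rm cor}$ with $$\widetilde{\boldsymbol F}^{\rm cor}=\big(\widetilde{\boldsymbol F}_L^{\rm num}(\eta)-\widetilde{\boldsymbol F}^{\rm loc}(-1,\eta)\big)g_L(\xi)+\big(\widetilde{\boldsymbol F}_R^{\rm num}(\eta)-\widetilde{\boldsymbol F}^{\rm loc}(1,\eta)\big)g_R(\xi),$$ $$\widetilde{\boldsymbol G}^{\rm cor}=\big(\widetilde{\boldsymbol G}_L^{\rm num}(\xi)-\widetilde{\boldsymbol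 G}^{\rm loc}(\xi,-1)\big)g_L(\eta)+\big(\widetilde{\boldsymbol G}_R^{\rm num}(\xi)-\widetilde{\boldsymbol G}^{\rm loc}(\xi,1)\big)g_R(\eta),$$ where $g_L,g_R\in P^{k+2l}$ are the right and left Radau polynomials, satisfying $g_L(-1)=g_R(1)=1$, $g_L(1)=g_R(-1)=0$. The numerical fluxes are $\widetilde{\boldsymbol F}^{\rm num}=|J|\,\|\nabla\xi\|_2\,\mathrm{sign}(\boldsymbol n\cdot\nabla\xi)\,\boldsymbol F_n^{\rm com}$ and $\widetilde{\boldsymbol G}^{\rm num}=|J|\,\|\nabla\eta\|_2\,\mathrm{sign}(\boldsymbol n\cdot\nabla\eta)\,\boldsymbol F_n^{\rm com}$, evaluated with the exact metrics at flux points (the intersections of the element boundary with the coordinate lines through solution points); $\boldsymbol n$ is the outward unit normal in the physical domain, and $\boldsymbol F_n^{\rm com}$ is the common normal flux given by the local Lax--Friedrichs solver, which equals $\boldsymbol n\cdot(\boldsymbol F,\boldsymbol G)$ when the two neighbouring states agree. **Meaning of "numerically satisfies the GCL".** In a freestream, i.e. $\boldsymbol Q$ constant in space and time (in all elements), $\boldsymbol F$ and $\boldsymbol G$ are constant vectors, and the local fluxes are $\widetilde{\boldsymbol F}^{\rm loc}=\sum_j(|J|\xi_x\boldsymbol F+|J|\xi_y\boldsymbol G)_j^{\rm SP}w_j^r$, $\widetilde{\boldsymbol G}^{\rm loc}=\sum_j(|J|\eta_x\boldsymbol F+|J|\eta_y\boldsymbol G)_j^{\rm SP}w_j^r$. The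 scheme numerically satisfies the GCL if (a) the metric identities hold discretely, $$\sum_j(|J|\xi_x)_j^{\rm SP}\frac{\partial w_j^r}{\partial\xi}+\sum_j(|J|\eta_x)_j^{\rm SP}\frac{\partial w_j^r}{\partial\eta}=0,\qquad \sum_j(|J|\xi_y)_j^{\rm SP}\frac{\partial w_j^r}{\partial\xi}+\sum_j(|J|\eta_y)_j^{\rm SP}\frac{\partial w_j^r}{\partial\eta}=0,$$ and (b) for every freestream $\partial_\xi\widetilde{\boldsymbol F}^{\rm loc}+\partial_\eta\widetilde{\boldsymbol G}^{\rm loc}+\widetilde{\boldsymbol\delta}^{\rm cor}=0$. Exact arithmetic is assumed (machine round-off is neglected). *)

theory Defs
  imports "HOL-Analysis.Analysis" "HOL-Computational_Algebra.Polynomial"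
begin

section \<open>Polynomial spaces and partial derivatives\<close>

text \<open>\<open>tensor_poly a b\<close> is $P^a(\xi)\otimes P^b(\eta)$; $\mathbb{Q}^a$ is \<open>tensor_poly a a\<close>.\<close>

definition tensor_poly :: "nat \<Rightarrow> nat \<Rightarrow> (real \<Rightarrow> real \<Rightarrow> real) set" where
  "tensor_poly a b =
     {f. \<exists>c :: nat \<Rightarrow> nat \<Rightarrow> real. \<forall>\<xi> \<eta>. f \<xi> \<eta> = (\<Sum>i\<le>a. \<Sum>j\<le>b. c i j * \<xi> ^ i * \<eta> ^ j)}"

definition d_xi :: "(real \<Rightarrow> real \<Rightarrow> real) \<Rightarrow> real \<Rightarrow> real \<Rightarrow> real" where
  "d_xi f \<xi> \<eta> = deriv (\<lambda>s. f s \<eta>) \<xi>"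

definition d_eta :: "(real \<Rightarrow> real \<Rightarrow> real) \<Rightarrow> real \<Rightarrow> real \<Rightarrow> real" where
  "d_eta f \<xi> \<eta> = deriv (\<lambda>s. f \<xi> s) \<eta>"

section \<open>Metrics\<close>

text \<open>The fields \<open>Jxi_x\<close>, \<dots>, \<open>Jeta_y\<close> hold the products $|J|\xi_x$, \<dots>, $|J|\eta_y$.
  \<open>Jac\<close> is the Jacobian determinant $|J|$ with its sign.\<close>

record metrics =
  Jac :: "real \<Rightarrow> real \<Rightarrow> real"
  Jxi_x :: "real \<Rightarrow> real \<Rightarrow> real"
  Jxi_y :: "real \<Rightarrow> real \<Rightarrow> real"
  Jeta_x :: "real \<Rightarrow> real \<Rightarrow> real"
  Jeta_y :: "real \<Rightarrow> real \<Rightarrow> real"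

definition nonconservative_metrics ::
    "(real \<Rightarrow> real \<Rightarrow> real) \<Rightarrow> (real \<Rightarrow> real \<Rightarrow> real) \<Rightarrow> metrics" where
  "nonconservative_metrics x y =
     \<lparr> Jac = (\<lambda>\<xi> \<eta>. d_xi x \<xi> \<eta> * d_eta y \<xi> \<eta> - d_eta x \<xi> \<eta> * d_xi y \<xi> \<eta>),
       Jxi_x = (\<lambda>\<xi> \<eta>. d_eta y \<xi> \<eta>),
       Jxi_y = (\<lambda>\<xi> \<eta>. - d_eta x \<xi> \<eta>),
       Jeta_x = (\<lambda>\<xi> \<eta>. - d_xi y \<xi> \<eta>),
       Jeta_y = (\<lambda>\<xi> \<eta>. d_xi x \<xi> \<eta>) \<rparr>"

text \<open>
  For the conservative formulas the map is regarded as the map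
  $(\xi,\eta,\tau)\mapsto(x,y,t)$ with $t=\tau$ and with $x$, $y$ independent of $\tau$.
  Each metric is then a minor $f_a g_b - f_b g_a$ of the Jacobian matrix, which equals
  both $(f g_b)_a - (f g_a)_b$ and $(f_a g)_b - (f_b g)_a$.  The parameter \<open>\<theta>\<close> weights
  these two curl forms: \<open>\<theta> = 0\<close> is the Thomas--Lombard form and \<open>\<theta> = 1/2\<close> the symmetric
  one.
\<close>

type_synonym field3 = "real \<Rightarrow> real \<Rightarrow> real \<Rightarrow> real"

definition D_xi :: "field3 \<Rightarrow> field3" where
  "D_xi f = (\<lambda>\<xi> \<eta> \<tau>. deriv (\<lambda>s. f s \<eta> \<tau>) \<xi>)"

definition D_eta :: "field3 \<Rightarrow> field3" where
  "D_eta f = (\<lambda>\<xi> \<eta> \<tau>. deriv (\<lambda>s. f \<xi> s \<tau>) \<eta>)"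

definition D_tau :: "field3 \<Rightarrow> field3" where
  "D_tau f = (\<lambda>\<xi> \<eta> \<tau>. deriv (\<lambda>s. f \<xi> \<eta> s) \<tau>)"

definition mult3 :: "field3 \<Rightarrow> field3 \<Rightarrow> field3" where
  "mult3 f g = (\<lambda>\<xi> \<eta> \<tau>. f \<xi> \<eta> \<tau> * g \<xi> \<eta> \<tau>)"

definition curl_form ::
    "real \<Rightarrow> (field3 \<Rightarrow> field3) \<Rightarrow> (field3 \<Rightarrow> field3) \<Rightarrow> field3 \<Rightarrow> field3 \<Rightarrow> field3" where
  "curl_form \<theta> Da Db f g = (\<lambda>\<xi> \<eta> \<tau>.
       \<theta> * (Da (mult3 f (Db g)) \<xi> \<eta> \<tau> - Db (mult3 f (Da g)) \<xi> \<eta> \<tau>)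
     + (1 - \<theta>) * (Db (mult3 (Da f) g) \<xi> \<eta> \<tau> - Da (mult3 (Db f) g) \<xi> \<eta> \<tau>))"

definition conservative_metrics ::
    "real \<Rightarrow> real \<Rightarrow> (real \<Rightarrow> real \<Rightarrow> real) \<Rightarrow> (real \<Rightarrow> real \<Rightarrow> real) \<Rightarrow> metrics" where
  "conservative_metrics \<theta> \<tau> x y =
     (let X = (\<lambda>\<xi> \<eta> \<tau>. x \<xi> \<eta>); Y = (\<lambda>\<xi> \<eta> \<tau>. y \<xi> \<eta>); T = (\<lambda>\<xi> \<eta> \<tau>. \<tau>) in
     \<lparr> Jac = (\<lambda>\<xi> \<eta>. curl_form \<theta> D_xi D_eta X Y \<xi> \<eta> \<tau>),
       Jxi_x = (\<lambda>\<xi> \<eta>. curl_form \<theta> D_eta D_tau Y T \<xi> \<eta> \<tau>),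
       Jxi_y = (\<lambda>\<xi> \<eta>. curl_form \<theta> D_eta D_tau T X \<xi> \<eta> \<tau>),
       Jeta_x = (\<lambda>\<xi> \<eta>. curl_form \<theta> D_tau D_xi Y T \<xi> \<eta> \<tau>),
       Jeta_y = (\<lambda>\<xi> \<eta>. curl_form \<theta> D_tau D_xi T X \<xi> \<eta> \<tau>) \<rparr>)"

definition nabla_xi :: "metrics \<Rightarrow> real \<times> real \<Rightarrow> real \<times> real" where
  "nabla_xi m = (\<lambda>(\<xi>, \<eta>). (Jxi_x m \<xi> \<eta> / Jac m \<xi> \<eta>, Jxi_y m \<xi> \<eta> / Jac m \<xi> \<eta>))"

definition nabla_eta :: "metrics \<Rightarrow> real \<times> real \<Rightarrow> real \<times> real" where
  "nabla_eta m = (\<lambda>(\<xi>, \<eta>). (Jeta_x m \<xi> \<eta> / Jac m \<xi> \<eta>, Jeta_y m \<xi> \<eta> / Jac m \<xi> \<eta>))"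

section \<open>Gauss--Legendre points, Lagrange basis, Radau polynomials\<close>

text \<open>Rodrigues' formula.\<close>

definition legendre_poly :: "nat \<Rightarrow> real poly" where
  "legendre_poly n = smult (1 / (2 ^ n * fact n)) ((pderiv ^^ n) ([:-1, 0, 1:] ^ n))"

text \<open>\<open>gauss_pt n i\<close> is the \<open>i\<close>-th of the \<open>n\<close> points (in increasing order, from \<open>i = 0\<close>).\<close>

definition gauss_pt :: "nat \<Rightarrow> nat \<Rightarrow> real" where
  "gauss_pt n i = sorted_list_of_set {s. poly (legendre_poly n) s = 0} ! i"

definition lagrange :: "nat \<Rightarrow> nat \<Rightarrow> real poly" where
  "lagrange n i = (\<Prod>m\<in>{..<n} - {i}. smult (1 / (gauss_pt n i - gauss_pt n m)) [:- gauss_pt n m, 1:])"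

definition tensor_lagrange :: "nat \<Rightarrow> nat \<Rightarrow> nat \<Rightarrow> real \<Rightarrow> real \<Rightarrow> real" where
  "tensor_lagrange n i j \<xi> \<eta> = poly (lagrange n i) \<xi> * poly (lagrange n j) \<eta>"

text \<open>\<open>radau_L\<close> is the right Radau polynomial, which vanishes at \<open>1\<close> and corrects the
  boundary at \<open>-1\<close>; \<open>radau_R\<close> is the left one.\<close>

definition radau_L :: "nat \<Rightarrow> real poly" where
  "radau_L n = smult ((-1) ^ n / 2) (legendre_poly n - legendre_poly (n - 1))"

definition radau_R :: "nat \<Rightarrow> real poly" where
  "radau_R n = smult (1 / 2) (legendre_poly n + legendre_poly (n - 1))"

section \<open>Element boundary\<close>

datatype edge = West | East | South | North

fun edge_pt :: "edge \<Rightarrow> real \<Rightarrow> real \<times> real" where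
  "edge_pt West s = (-1, s)"
| "edge_pt East s = (1, s)"
| "edge_pt South s = (s, -1)"
| "edge_pt North s = (s, 1)"

text \<open>Physical tangent vector of an edge, and the physical image of the outward direction
  $\mp e_\xi$, $\mp e_\eta$ of the reference square.\<close>

definition phys_xi :: "(real \<Rightarrow> real \<Rightarrow> real) \<Rightarrow> (real \<Rightarrow> real \<Rightarrow> real) \<Rightarrow> real \<times> real \<Rightarrow> real \<times> real" where
  "phys_xi x y = (\<lambda>(\<xi>, \<eta>). (d_xi x \<xi> \<eta>, d_xi y \<xi> \<eta>))"

definition phys_eta :: "(real \<Rightarrow> real \<Rightarrow> real) \<Rightarrow> (real \<Rightarrow> real \<Rightarrow> real) \<Rightarrow> real \<times> real \<Rightarrow> real \<times> real" where
  "phys_eta x y = (\<lambda>(\<xi>, \<eta>). (d_eta x \<xi> \<eta>, d_eta y \<xi> \<eta>))"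

fun edge_tangent ::
    "(real \<Rightarrow> real \<Rightarrow> real) \<Rightarrow> (real \<Rightarrow> real \<Rightarrow> real) \<Rightarrow> edge \<Rightarrow> real \<Rightarrow> real \<times> real" where
  "edge_tangent x y West s = phys_eta x y (edge_pt West s)"
| "edge_tangent x y East s = phys_eta x y (edge_pt East s)"
| "edge_tangent x y South s = phys_xi x y (edge_pt South s)"
| "edge_tangent x y North s = phys_xi x y (edge_pt North s)"

fun edge_outward ::
    "(real \<Rightarrow> real \<Rightarrow> real) \<Rightarrow> (real \<Rightarrow> real \<Rightarrow> real) \<Rightarrow> edge \<Rightarrow> real \<Rightarrow> real \<times> real" where
  "edge_outward x y West s = - phys_xi x y (edge_pt West s)"
| "edge_outward x y East s = phys_xi x y (edge_pt East s)"
| "edge_outward x y South s = - phys_eta x y (edge_pt South s)"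
| "edge_outward x y North s = phys_eta x y (edge_pt North s)"

definition outward_unit_normal ::
    "(real \<Rightarrow> real \<Rightarrow> real) \<Rightarrow> (real \<Rightarrow> real \<Rightarrow> real) \<Rightarrow> edge \<Rightarrow> real \<Rightarrow> real \<times> real" where
  "outward_unit_normal x y e s =
     (THE \<nu>. norm \<nu> = 1 \<and> \<nu> \<bullet> edge_tangent x y e s = 0 \<and> \<nu> \<bullet> edge_outward x y e s > 0)"

fun edge_nabla :: "metrics \<Rightarrow> edge \<Rightarrow> real \<Rightarrow> real \<times> real" where
  "edge_nabla m West s = nabla_xi m (edge_pt West s)"
| "edge_nabla m East s = nabla_xi m (edge_pt East s)"
| "edge_nabla m South s = nabla_eta m (edge_pt South s)"
| "edge_nabla m North s = nabla_eta m (edge_pt North s)"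

section \<open>Flux reconstruction scheme\<close>

text \<open>
  Arguments of the following definitions: \<open>n\<close> is the number of solution points per
  direction, \<open>F\<close> and \<open>G\<close> are the physical flux functions, \<open>Qh\<close> is the solution in the
  element, and \<open>Qx e s\<close> is the state of the neighbour at the point \<open>edge_pt e s\<close> of the edge
  \<open>e\<close>.  \<open>\<alpha> \<nu> QI QE\<close> is the local maximal wave speed in direction \<open>\<nu>\<close> that the
  Lax--Friedrichs solver uses; it may be any function of the normal and the two states.
\<close>

definition normal_flux ::
    "(real^'v \<Rightarrow> real^'v) \<Rightarrow> (real^'v \<Rightarrow> real^'v) \<Rightarrow> real \<times> real \<Rightarrow> real^'v \<Rightarrow> real^'v" where
  "normal_flux F G \<nu> Q = fst \<nu> *\<^sub>R F Q + snd \<nu> *\<^sub>R G Q"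

definition lax_friedrichs ::
    "(real^'v \<Rightarrow> real^'v) \<Rightarrow> (real^'v \<Rightarrow> real^'v) \<Rightarrow>
     (real \<times> real \<Rightarrow> real^'v \<Rightarrow> real^'v \<Rightarrow> real) \<Rightarrow>
     real \<times> real \<Rightarrow> real^'v \<Rightarrow> real^'v \<Rightarrow> real^'v" where
  "lax_friedrichs F G \<alpha> \<nu> QI QE =
     (1/2) *\<^sub>R (normal_flux F G \<nu> QI + normal_flux F G \<nu> QE) - (\<alpha> \<nu> QI QE / 2) *\<^sub>R (QE - QI)"

definition F_loc ::
    "nat \<Rightarrow> metrics \<Rightarrow> (real^'v \<Rightarrow> real^'v) \<Rightarrow> (real^'v \<Rightarrow> real^'v) \<Rightarrow>
     (real \<Rightarrow> real \<Rightarrow> real^'v) \<Rightarrow> real \<Rightarrow> real \<Rightarrow> real^'v" where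
  "F_loc n m F G Qh \<xi> \<eta> = (\<Sum>i<n. \<Sum>j<n.
     (let a = gauss_pt n i; b = gauss_pt n j in
      tensor_lagrange n i j \<xi> \<eta> *\<^sub>R (Jxi_x m a b *\<^sub>R F (Qh a b) + Jxi_y m a b *\<^sub>R G (Qh a b))))"

definition G_loc ::
    "nat \<Rightarrow> metrics \<Rightarrow> (real^'v \<Rightarrow> real^'v) \<Rightarrow> (real^'v \<Rightarrow> real^'v) \<Rightarrow>
     (real \<Rightarrow> real \<Rightarrow> real^'v) \<Rightarrow> real \<Rightarrow> real \<Rightarrow> real^'v" where
  "G_loc n m F G Qh \<xi> \<eta> = (\<Sum>i<n. \<Sum>j<n.
     (let a = gauss_pt n i; b = gauss_pt n j in
      tensor_lagrange n i j \<xi> \<eta> *\<^sub>R (Jeta_x m a b *\<^sub>R F (Qh a b) + Jeta_y m a b *\<^sub>R G (Qh a b))))"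

definition edge_flux ::
    "(real \<Rightarrow> real \<Rightarrow> real) \<Rightarrow> (real \<Rightarrow> real \<Rightarrow> real) \<Rightarrow> metrics \<Rightarrow>
     (real^'v \<Rightarrow> real^'v) \<Rightarrow> (real^'v \<Rightarrow> real^'v) \<Rightarrow>
     (real \<times> real \<Rightarrow> real^'v \<Rightarrow> real^'v \<Rightarrow> real) \<Rightarrow>
     (real \<Rightarrow> real \<Rightarrow> real^'v) \<Rightarrow> (edge \<Rightarrow> real \<Rightarrow> real^'v) \<Rightarrow> edge \<Rightarrow> real \<Rightarrow> real^'v" where
  "edge_flux x y m F G \<alpha> Qh Qx e s =
     (let \<nu> = outward_unit_normal x y e s; p = edge_pt e s; d = edge_nabla m e s in
      (Jac m (fst p) (snd p) * norm d * sgn (\<nu> \<bullet> d)) *\<^sub>R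
        lax_friedrichs F G \<alpha> \<nu> (Qh (fst p) (snd p)) (Qx e s))"

text \<open>Along an edge the numerical flux is the polynomial of degree at most \<open>n - 1\<close> through
  its values at the \<open>n\<close> flux points.\<close>

definition num_flux ::
    "nat \<Rightarrow> (real \<Rightarrow> real \<Rightarrow> real) \<Rightarrow> (real \<Rightarrow> real \<Rightarrow> real) \<Rightarrow> metrics \<Rightarrow>
     (real^'v \<Rightarrow> real^'v) \<Rightarrow> (real^'v \<Rightarrow> real^'v) \<Rightarrow>
     (real \<times> real \<Rightarrow> real^'v \<Rightarrow> real^'v \<Rightarrow> real) \<Rightarrow>
     (real \<Rightarrow> real \<Rightarrow> real^'v) \<Rightarrow> (edge \<Rightarrow> real \<Rightarrow> real^'v) \<Rightarrow> edge \<Rightarrow> real \<Rightarrow> real^'v" where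
  "num_flux n x y m F G \<alpha> Qh Qx e s =
     (\<Sum>j<n. poly (lagrange n j) s *\<^sub>R edge_flux x y m F G \<alpha> Qh Qx e (gauss_pt n j))"

definition F_cor ::
    "nat \<Rightarrow> (real \<Rightarrow> real \<Rightarrow> real) \<Rightarrow> (real \<Rightarrow> real \<Rightarrow> real) \<Rightarrow> metrics \<Rightarrow>
     (real^'v \<Rightarrow> real^'v) \<Rightarrow> (real^'v \<Rightarrow> real^'v) \<Rightarrow>
     (real \<times> real \<Rightarrow> real^'v \<Rightarrow> real^'v \<Rightarrow> real) \<Rightarrow>
     (real \<Rightarrow> real \<Rightarrow> real^'v) \<Rightarrow> (edge \<Rightarrow> real \<Rightarrow> real^'v) \<Rightarrow> real \<Rightarrow> real \<Rightarrow> real^'v" where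
  "F_cor n x y m F G \<alpha> Qh Qx \<xi> \<eta> =
     poly (radau_L n) \<xi> *\<^sub>R (num_flux n x y m F G \<alpha> Qh Qx West \<eta> - F_loc n m F G Qh (-1) \<eta>)
   + poly (radau_R n) \<xi> *\<^sub>R (num_flux n x y m F G \<alpha> Qh Qx East \<eta> - F_loc n m F G Qh 1 \<eta>)"

definition G_cor ::
    "nat \<Rightarrow> (real \<Rightarrow> real \<Rightarrow> real) \<Rightarrow> (real \<Rightarrow> real \<Rightarrow> real) \<Rightarrow> metrics \<Rightarrow>
     (real^'v \<Rightarrow> real^'v) \<Rightarrow> (real^'v \<Rightarrow> real^'v) \<Rightarrow>
     (real \<times> real \<Rightarrow> real^'v \<Rightarrow> real^'v \<Rightarrow> real) \<Rightarrow>
     (real \<Rightarrow> real \<Rightarrow> real^'v) \<Rightarrow> (edge \<Rightarrow> real \<Rightarrow> real^'v) \<Rightarrow> real \<Rightarrow> real \<Rightarrow> real^'v" where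
  "G_cor n x y m F G \<alpha> Qh Qx \<xi> \<eta> =
     poly (radau_L n) \<eta> *\<^sub>R (num_flux n x y m F G \<alpha> Qh Qx South \<xi> - G_loc n m F G Qh \<xi> (-1))
   + poly (radau_R n) \<eta> *\<^sub>R (num_flux n x y m F G \<alpha> Qh Qx North \<xi> - G_loc n m F G Qh \<xi> 1)"

definition vd_xi :: "(real \<Rightarrow> real \<Rightarrow> real^'v) \<Rightarrow> real \<Rightarrow> real \<Rightarrow> real^'v" where
  "vd_xi H \<xi> \<eta> = vector_derivative (\<lambda>s. H s \<eta>) (at \<xi>)"

definition vd_eta :: "(real \<Rightarrow> real \<Rightarrow> real^'v) \<Rightarrow> real \<Rightarrow> real \<Rightarrow> real^'v" where
  "vd_eta H \<xi> \<eta> = vector_derivative (\<lambda>s. H \<xi> s) (at \<eta>)"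

definition delta_cor ::
    "nat \<Rightarrow> (real \<Rightarrow> real \<Rightarrow> real) \<Rightarrow> (real \<Rightarrow> real \<Rightarrow> real) \<Rightarrow> metrics \<Rightarrow>
     (real^'v \<Rightarrow> real^'v) \<Rightarrow> (real^'v \<Rightarrow> real^'v) \<Rightarrow>
     (real \<times> real \<Rightarrow> real^'v \<Rightarrow> real^'v \<Rightarrow> real) \<Rightarrow>
     (real \<Rightarrow> real \<Rightarrow> real^'v) \<Rightarrow> (edge \<Rightarrow> real \<Rightarrow> real^'v) \<Rightarrow> real \<Rightarrow> real \<Rightarrow> real^'v" where
  "delta_cor n x y m F G \<alpha> Qh Qx \<xi> \<eta> =
     vd_xi (F_cor n x y m F G \<alpha> Qh Qx) \<xi> \<eta> + vd_eta (G_cor n x y m F G \<alpha> Qh Qx) \<xi> \<eta>"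

text \<open>The scheme is $\partial_t(|J| Q_h) + \mathrm{residual} = 0$.\<close>

definition fr_residual ::
    "nat \<Rightarrow> (real \<Rightarrow> real \<Rightarrow> real) \<Rightarrow> (real \<Rightarrow> real \<Rightarrow> real) \<Rightarrow> metrics \<Rightarrow>
     (real^'v \<Rightarrow> real^'v) \<Rightarrow> (real^'v \<Rightarrow> real^'v) \<Rightarrow>
     (real \<times> real \<Rightarrow> real^'v \<Rightarrow> real^'v \<Rightarrow> real) \<Rightarrow>
     (real \<Rightarrow> real \<Rightarrow> real^'v) \<Rightarrow> (edge \<Rightarrow> real \<Rightarrow> real^'v) \<Rightarrow> real \<Rightarrow> real \<Rightarrow> real^'v" where
  "fr_residual n x y m F G \<alpha> Qh Qx \<xi> \<eta> =
     vd_xi (F_loc n m F G Qh) \<xi> \<eta> + vd_eta (G_loc n m F G Qh) \<xi> \<eta>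
     + delta_cor n x y m F G \<alpha> Qh Qx \<xi> \<eta>"

section \<open>Geometric conservation law\<close>

definition discrete_metric_identities :: "nat \<Rightarrow> metrics \<Rightarrow> bool" where
  "discrete_metric_identities n m \<longleftrightarrow> (\<forall>\<xi>\<in>{-1..1}. \<forall>\<eta>\<in>{-1..1}.
     (\<Sum>i<n. \<Sum>j<n. Jxi_x m (gauss_pt n i) (gauss_pt n j) * d_xi (tensor_lagrange n i j) \<xi> \<eta>)
   + (\<Sum>i<n. \<Sum>j<n. Jeta_x m (gauss_pt n i) (gauss_pt n j) * d_eta (tensor_lagrange n i j) \<xi> \<eta>) = 0
   \<and> (\<Sum>i<n. \<Sum>j<n. Jxi_y m (gauss_pt n i) (gauss_pt n j) * d_xi (tensor_lagrange n i j) \<xi> \<eta>)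
   + (\<Sum>i<n. \<Sum>j<n. Jeta_y m (gauss_pt n i) (gauss_pt n j) * d_eta (tensor_lagrange n i j) \<xi> \<eta>) = 0)"

definition freestream ::
    "nat \<Rightarrow> real^'v \<Rightarrow> (real \<Rightarrow> real \<Rightarrow> real^'v) \<Rightarrow> (edge \<Rightarrow> real \<Rightarrow> real^'v) \<Rightarrow> bool" where
  "freestream k Q Qh Qx \<longleftrightarrow>
     (\<forall>v. (\<lambda>\<xi> \<eta>. Qh \<xi> \<eta> $ v) \<in> tensor_poly k k) \<and>
     (\<forall>\<xi>\<in>{-1..1}. \<forall>\<eta>\<in>{-1..1}. Qh \<xi> \<eta> = Q) \<and>
     (\<forall>e. \<forall>s\<in>{-1..1}. Qx e s = Q)"

definition freestream_preserving ::
    "nat \<Rightarrow> nat \<Rightarrow> (real \<Rightarrow> real \<Rightarrow> real) \<Rightarrow> (real \<Rightarrow> real \<Rightarrow> real) \<Rightarrow> metrics \<Rightarrow>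
     (real^'v \<Rightarrow> real^'v) \<Rightarrow> (real^'v \<Rightarrow> real^'v) \<Rightarrow>
     (real \<times> real \<Rightarrow> real^'v \<Rightarrow> real^'v \<Rightarrow> real) \<Rightarrow> bool" where
  "freestream_preserving k n x y m F G \<alpha> \<longleftrightarrow>
     (\<forall>Q Qh Qx. freestream k Q Qh Qx \<longrightarrow>
        (\<forall>\<xi>\<in>{-1..1}. \<forall>\<eta>\<in>{-1..1}. fr_residual n x y m F G \<alpha> Qh Qx \<xi> \<eta> = 0))"

text \<open>With $Q_h$ in $\mathbb{Q}^k$ and the coordinates in $\mathbb{Q}^l$, $|J| Q_h$ is in
  $\mathbb{Q}^{k+2l-1}$ and is determined by \<open>k + 2 * l\<close> points per direction.\<close>

definition numerically_satisfies_GCL ::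
    "nat \<Rightarrow> nat \<Rightarrow> (real \<Rightarrow> real \<Rightarrow> real) \<Rightarrow> (real \<Rightarrow> real \<Rightarrow> real) \<Rightarrow> metrics \<Rightarrow>
     (real^'v \<Rightarrow> real^'v) \<Rightarrow> (real^'v \<Rightarrow> real^'v) \<Rightarrow>
     (real \<times> real \<Rightarrow> real^'v \<Rightarrow> real^'v \<Rightarrow> real) \<Rightarrow> bool" where
  "numerically_satisfies_GCL k l x y m F G \<alpha> \<longleftrightarrow>
     discrete_metric_identities (k + 2 * l) m \<and>
     freestream_preserving k (k + 2 * l) x y m F G \<alpha>"

section \<open>Polynomial degrees of the scheme\<close>

lemma tensor_polyI:
  assumes "\<And>\<xi> \<eta>. f \<xi> \<eta> = poly p \<xi> * poly q \<eta>" "degree p \<le> a" "degree q \<le> b"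
  shows "f \<in> tensor_poly a b"
proof -
  have e: "poly r z = (\<Sum>i\<le>c. coeff r i * z ^ i)" if "degree r \<le> c" for r :: "real poly" and z c
    unfolding poly_altdef using that
    by (intro sum.mono_neutral_left) (auto simp: coeff_eq_0)
  show ?thesis unfolding tensor_poly_def mem_Collect_eq
    by (rule exI[of _ "\<lambda>i j. coeff p i * coeff q j"])
       (simp add: assms(1) e[OF assms(2)] e[OF assms(3)] sum_product algebra_simps)
qed

lemma tensor_poly_add:
  assumes "f \<in> tensor_poly a b" "g \<in> tensor_poly a b"
  shows "(\<lambda>\<xi> \<eta>. f \<xi> \<eta> + g \<xi> \<eta>) \<in> tensor_poly a b"
proof -
  obtain c d where "\<forall>\<xi> \<eta>. f \<xi> \<eta> = (\<Sum>i\<le>a. \<Sum>j\<le>b. c i j * \<xi> ^ i * \<eta> ^ j)"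
      "\<forall>\<xi> \<eta>. g \<xi> \<eta> = (\<Sum>i\<le>a. \<Sum>j\<le>b. d i j * \<xi> ^ i * \<eta> ^ j)"
    using assms unfolding tensor_poly_def by blast
  then show ?thesis unfolding tensor_poly_def mem_Collect_eq
    by (intro exI[of _ "\<lambda>i j. c i j + d i j"]) (simp add: sum.distrib algebra_simps)
qed

lemma tensor_poly_sum:
  assumes "\<And>i. i \<in> I \<Longrightarrow> f i \<in> tensor_poly a b"
  shows "(\<lambda>\<xi> \<eta>. \<Sum>i\<in>I. f i \<xi> \<eta>) \<in> tensor_poly a b"
proof (cases "finite I")
  case True
  then show ?thesis using assms
  proof (induction I rule: finite_induct)
    case empty
    show ?case by (rule tensor_polyI[where p = 0 and q = 0]) auto
  next
    case (insert i I)
    then show ?case using tensor_poly_add[of "f i" a b "\<lambda>\<xi> \<eta>. \<Sum>i\<in>I. f i \<xi> \<eta>"] by simp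
  qed
next
  case False
  then show ?thesis by (intro tensor_polyI[where p = 0 and q = 0]) auto
qed

lemma degree_lagrange: "degree (lagrange n i) \<le> n - 1" if "i < n"
proof -
  have "degree (lagrange n i) \<le> (\<Sum>m\<in>{..<n} - {i}. 1)"
    unfolding lagrange_def
    by (rule order.trans[OF degree_prod_sum_le])
       (simp, rule sum_mono, simp only: comp_def, rule order.trans[OF degree_smult_le], simp)
  then show ?thesis using that by simp
qed

lemma degree_legendre: "degree (legendre_poly n) \<le> n"
proof -
  have h: "degree ((pderiv ^^ i) p) = degree p - i" for i and p :: "real poly"
    by (induction i) (auto simp: degree_pderiv)
  show ?thesis unfolding legendre_poly_def by (simp add: h degree_power_eq)
qed

lemma degree_radau: "degree (radau_L n) \<le> n" "degree (radau_R n) \<le> n"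
  using degree_legendre[of n] degree_legendre[of "n - 1"]
  by (auto simp: radau_L_def radau_R_def intro!: order.trans[OF degree_smult_le] degree_diff_le degree_add_le)

lemma tensor_lagrange_degree:
  assumes "i < n" "j < n"
  shows "(\<lambda>\<xi> \<eta>. tensor_lagrange n i j \<xi> \<eta> * c) \<in> tensor_poly (n - 1) (n - 1)"
  by (rule tensor_polyI[where p = "lagrange n i" and q = "smult c (lagrange n j)"])
     (use assms degree_lagrange in \<open>auto simp: tensor_lagrange_def intro: order.trans[OF degree_smult_le]\<close>)

lemma loc_degree:
  fixes F G :: "real^'v \<Rightarrow> real^'v"
  shows "(\<lambda>\<xi> \<eta>. F_loc n m F G Qh \<xi> \<eta> $ v) \<in> tensor_poly (n - 1) (n - 1)"
    and "(\<lambda>\<xi> \<eta>. G_loc n m F G Qh \<xi> \<eta> $ v) \<in> tensor_poly (n - 1) (n - 1)"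
  unfolding F_loc_def G_loc_def Let_def sum_component vector_scaleR_component real_scaleR_def
  by (intro tensor_poly_sum tensor_lagrange_degree; simp only: lessThan_iff
        vector_scaleR_component real_scaleR_def)+

lemma lagrange_comb:
  fixes c :: "nat \<Rightarrow> real"
  obtains p where "degree p \<le> n - 1" "\<And>s. (\<Sum>j<n. poly (lagrange n j) s * c j) = poly p s"
proof
  show "degree (\<Sum>j<n. smult (c j) (lagrange n j)) \<le> n - 1"
    by (rule degree_sum_le) (auto intro!: order.trans[OF degree_smult_le] degree_lagrange simp del: One_nat_def)
qed (simp add: poly_sum mult.commute)

lemma num_flux_poly:
  fixes F G :: "real^'v \<Rightarrow> real^'v"
  obtains p where "degree p \<le> n - 1" "\<And>s. num_flux n x y m F G \<alpha> Qh Qx e s $ v = poly p s"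
  by (rule lagrange_comb[of n "\<lambda>j. edge_flux x y m F G \<alpha> Qh Qx e (gauss_pt n j) $ v"])
     (rule that, simp_all add: num_flux_def)

lemma F_loc_trace_poly:
  fixes F G :: "real^'v \<Rightarrow> real^'v"
  obtains p where "degree p \<le> n - 1" "\<And>s. F_loc n m F G Qh b s $ v = poly p s"
proof -
  define c where "c = (\<lambda>j. \<Sum>i<n. poly (lagrange n i) b *
    ((Jxi_x m (gauss_pt n i) (gauss_pt n j) *\<^sub>R F (Qh (gauss_pt n i) (gauss_pt n j))
           + Jxi_y m (gauss_pt n i) (gauss_pt n j) *\<^sub>R G (Qh (gauss_pt n i) (gauss_pt n j))) $ v))"
  obtain p where p: "degree p \<le> n - 1" "\<And>s. (\<Sum>j<n. poly (lagrange n j) s * c j) = poly p s"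
    using lagrange_comb[of n c] by metis
  have "F_loc n m F G Qh b s $ v = (\<Sum>j<n. poly (lagrange n j) s * c j)" for s
    unfolding F_loc_def Let_def sum_component vector_scaleR_component tensor_lagrange_def c_def
    by (subst sum.swap) (simp add: sum_distrib_left mult_ac)
  then show ?thesis using p by (intro that[of p]) simp_all
qed

lemma G_loc_trace_poly:
  fixes F G :: "real^'v \<Rightarrow> real^'v"
  obtains p where "degree p \<le> n - 1" "\<And>s. G_loc n m F G Qh s b $ v = poly p s"
proof -
  define c where "c = (\<lambda>i. \<Sum>j<n. poly (lagrange n j) b *
    ((Jeta_x m (gauss_pt n i) (gauss_pt n j) *\<^sub>R F (Qh (gauss_pt n i) (gauss_pt n j))
           + Jeta_y m (gauss_pt n i) (gauss_pt n j) *\<^sub>R G (Qh (gauss_pt n i) (gauss_pt n j))) $ v))"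
  obtain p where p: "degree p \<le> n - 1" "\<And>s. (\<Sum>i<n. poly (lagrange n i) s * c i) = poly p s"
    using lagrange_comb[of n c] by metis
  have "G_loc n m F G Qh s b $ v = (\<Sum>i<n. poly (lagrange n i) s * c i)" for s
    unfolding G_loc_def Let_def sum_component vector_scaleR_component tensor_lagrange_def c_def
    by (simp add: sum_distrib_left mult_ac)
  then show ?thesis using p by (intro that[of p]) simp_all
qed

lemma F_cor_poly:
  fixes F G :: "real^'v \<Rightarrow> real^'v"
  obtains p q where "degree p \<le> n - 1" "degree q \<le> n - 1"
    "\<And>\<xi> \<eta>. F_cor n x y m F G \<alpha> Qh Qx \<xi> \<eta> $ v
        = poly (radau_L n) \<xi> * poly p \<eta> + poly (radau_R n) \<xi> * poly q \<eta>"
proof -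
  obtain a where a: "degree a \<le> n - 1" "\<And>s. num_flux n x y m F G \<alpha> Qh Qx West s $ v = poly a s"
    by (rule num_flux_poly[of n x y m F G \<alpha> Qh Qx West v]) blast
  obtain b where b: "degree b \<le> n - 1" "\<And>s. num_flux n x y m F G \<alpha> Qh Qx East s $ v = poly b s"
    by (rule num_flux_poly[of n x y m F G \<alpha> Qh Qx East v]) blast
  obtain c where c: "degree c \<le> n - 1" "\<And>s. F_loc n m F G Qh (-1) s $ v = poly c s"
    by (rule F_loc_trace_poly[of n m F G Qh "(-1)" v]) blast
  obtain d where d: "degree d \<le> n - 1" "\<And>s. F_loc n m F G Qh 1 s $ v = poly d s"
    by (rule F_loc_trace_poly[of n m F G Qh "1" v]) blast
  show ?thesis
    by (rule that[of "a - c" "b - d"])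
       (use a b c d in \<open>auto simp: F_cor_def intro: degree_diff_le\<close>)
qed

lemma G_cor_poly:
  fixes F G :: "real^'v \<Rightarrow> real^'v"
  obtains p q where "degree p \<le> n - 1" "degree q \<le> n - 1"
    "\<And>\<xi> \<eta>. G_cor n x y m F G \<alpha> Qh Qx \<xi> \<eta> $ v
        = poly (radau_L n) \<eta> * poly p \<xi> + poly (radau_R n) \<eta> * poly q \<xi>"
proof -
  obtain a where a: "degree a \<le> n - 1" "\<And>s. num_flux n x y m F G \<alpha> Qh Qx South s $ v = poly a s"
    by (rule num_flux_poly[of n x y m F G \<alpha> Qh Qx South v]) blast
  obtain b where b: "degree b \<le> n - 1" "\<And>s. num_flux n x y m F G \<alpha> Qh Qx North s $ v = poly b s"
    by (rule num_flux_poly[of n x y m F G \<alpha> Qh Qx North v]) blast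
  obtain c where c: "degree c \<le> n - 1" "\<And>s. G_loc n m F G Qh s (-1) $ v = poly c s"
    by (rule G_loc_trace_poly[of n m F G Qh "(-1)" v]) blast
  obtain d where d: "degree d \<le> n - 1" "\<And>s. G_loc n m F G Qh s 1 $ v = poly d s"
    by (rule G_loc_trace_poly[of n m F G Qh "1" v]) blast
  show ?thesis
    by (rule that[of "a - c" "b - d"])
       (use a b c d in \<open>auto simp: G_cor_def intro: degree_diff_le\<close>)
qed

lemma F_cor_degree:
  fixes F G :: "real^'v \<Rightarrow> real^'v"
  shows "(\<lambda>\<xi> \<eta>. F_cor n x y m F G \<alpha> Qh Qx \<xi> \<eta> $ v) \<in> tensor_poly n (n - 1)"
proof -
  obtain p q where "degree p \<le> n - 1" "degree q \<le> n - 1" and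
    e: "\<And>\<xi> \<eta>. F_cor n x y m F G \<alpha> Qh Qx \<xi> \<eta> $ v
        = poly (radau_L n) \<xi> * poly p \<eta> + poly (radau_R n) \<xi> * poly q \<eta>"
    by (rule F_cor_poly[of n x y m F G \<alpha> Qh Qx v]) blast
  then show ?thesis unfolding e
    by (intro tensor_poly_add tensor_polyI[OF refl]) (simp_all add: degree_radau)
qed

lemma G_cor_degree:
  fixes F G :: "real^'v \<Rightarrow> real^'v"
  shows "(\<lambda>\<xi> \<eta>. G_cor n x y m F G \<alpha> Qh Qx \<xi> \<eta> $ v) \<in> tensor_poly (n - 1) n"
proof -
  obtain p q where "degree p \<le> n - 1" "degree q \<le> n - 1" and
    "\<And>\<xi> \<eta>. G_cor n x y m F G \<alpha> Qh Qx \<xi> \<eta> $ v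
        = poly (radau_L n) \<eta> * poly p \<xi> + poly (radau_R n) \<eta> * poly q \<xi>"
    by (rule G_cor_poly[of n x y m F G \<alpha> Qh Qx v]) blast
  moreover from this(3) have e: "G_cor n x y m F G \<alpha> Qh Qx \<xi> \<eta> $ v
        = poly p \<xi> * poly (radau_L n) \<eta> + poly q \<xi> * poly (radau_R n) \<eta>" for \<xi> \<eta>
    by simp
  ultimately show ?thesis unfolding e
    by (intro tensor_poly_add tensor_polyI[OF refl]) (simp_all add: degree_radau)
qed

lemma vector_derivative_poly:
  fixes f :: "real \<Rightarrow> real^'v"
  assumes "\<And>v s. f s $ v = poly (p v) s"
  shows "vector_derivative f (at s) $ v = poly (pderiv (p v)) s"
proof -
  have "(f has_vector_derivative (\<chi> v. poly (pderiv (p v)) s)) (at s)"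
    unfolding has_vector_derivative_def
    by (subst has_derivative_componentwise_within)
       (use poly_DERIV[of "p _" s] in
         \<open>auto simp: Basis_vec_def inner_axis assms has_field_derivative_def mult_commute_abs\<close>)
  then show ?thesis by (simp add: vector_derivative_at)
qed

lemma delta_cor_degree:
  fixes F G :: "real^'v \<Rightarrow> real^'v"
  shows "(\<lambda>\<xi> \<eta>. delta_cor n x y m F G \<alpha> Qh Qx \<xi> \<eta> $ v) \<in> tensor_poly (n - 1) (n - 1)"
proof -
  have "\<exists>p q. degree p \<le> n - 1 \<and> degree q \<le> n - 1 \<and>
    (\<forall>\<xi> \<eta>. F_cor n x y m F G \<alpha> Qh Qx \<xi> \<eta> $ v
        = poly (radau_L n) \<xi> * poly p \<eta> + poly (radau_R n) \<xi> * poly q \<eta>)" for v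
    by (rule F_cor_poly[of n x y m F G \<alpha> Qh Qx v]) blast
  then obtain p q where pq: "\<And>v. degree (p v) \<le> n - 1" "\<And>v. degree (q v) \<le> n - 1" and
    e: "\<And>v \<xi> \<eta>. F_cor n x y m F G \<alpha> Qh Qx \<xi> \<eta> $ v
        = poly (radau_L n) \<xi> * poly (p v) \<eta> + poly (radau_R n) \<xi> * poly (q v) \<eta>"
    by metis
  have "\<exists>p q. degree p \<le> n - 1 \<and> degree q \<le> n - 1 \<and>
    (\<forall>\<xi> \<eta>. G_cor n x y m F G \<alpha> Qh Qx \<xi> \<eta> $ v
        = poly (radau_L n) \<eta> * poly p \<xi> + poly (radau_R n) \<eta> * poly q \<xi>)" for v
    by (rule G_cor_poly[of n x y m F G \<alpha> Qh Qx v]) blast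
  then obtain r t where rt: "\<And>v. degree (r v) \<le> n - 1" "\<And>v. degree (t v) \<le> n - 1" and
    g: "\<And>v \<xi> \<eta>. G_cor n x y m F G \<alpha> Qh Qx \<xi> \<eta> $ v
        = poly (radau_L n) \<eta> * poly (r v) \<xi> + poly (radau_R n) \<eta> * poly (t v) \<xi>"
    by metis
  have 1: "vd_xi (F_cor n x y m F G \<alpha> Qh Qx) \<xi> \<eta> $ v
      = poly (pderiv (radau_L n)) \<xi> * poly (p v) \<eta> + poly (pderiv (radau_R n)) \<xi> * poly (q v) \<eta>"
    for \<xi> \<eta>
    unfolding vd_xi_def
    by (subst vector_derivative_poly[where p = "\<lambda>v. smult (poly (p v) \<eta>) (radau_L n)
          + smult (poly (q v) \<eta>) (radau_R n)"])
       (simp_all add: e pderiv_add pderiv_smult mult.commute)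
  have 2: "vd_eta (G_cor n x y m F G \<alpha> Qh Qx) \<xi> \<eta> $ v
      = poly (r v) \<xi> * poly (pderiv (radau_L n)) \<eta> + poly (t v) \<xi> * poly (pderiv (radau_R n)) \<eta>"
    for \<xi> \<eta>
    unfolding vd_eta_def
    by (subst vector_derivative_poly[where p = "\<lambda>v. smult (poly (r v) \<xi>) (radau_L n)
          + smult (poly (t v) \<xi>) (radau_R n)"])
       (simp_all add: g pderiv_add pderiv_smult mult.commute)
  show ?thesis
    unfolding delta_cor_def vector_add_component 1 2
    by (intro tensor_poly_add tensor_polyI[OF refl])
       (auto simp: degree_pderiv pq rt simp del: One_nat_def intro!: diff_le_mono degree_radau)
qed

end

theory Submission
  imports Defs
begin

text \<open>
  The metrics of a map in $\mathbb{Q}^l$ are first derivatives of the coordinates, so they lie in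
  $\mathbb{Q}^l$. Interpolation at $n = k + 2l$ points per direction reproduces $\mathbb{Q}^{n-1}$,
  and $l \le n - 1$, so in a freestream nothing is lost by interpolating:
  the discrete metric identities, and the divergence of the local fluxes as their combination with
  coefficients $\boldsymbol F$ and $\boldsymbol G$, are built from the exact analytic expressions $\partial_\xi y_\eta - \partial_\eta y_\xi$ and
  $-\partial_\xi x_\eta + \partial_\eta x_\xi$, which vanish by symmetry of mixed partial
  derivatives (\<open>metric_identities\<close>, \<open>tensor_interpolation_partials\<close>).

  The correction field vanishes because in a freestream there is no flux jump on the element
  boundary. On every edge the gradient $\nabla\xi$ or $\nabla\eta$ is a multiple of the unit normal
  $\boldsymbol n$, so that the factor
  $|J|\,\|\nabla\xi\|\,\mathrm{sign}(\boldsymbol n\cdot\nabla\xi)$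
  turns the normal flux $\boldsymbol n\cdot(\boldsymbol F,\boldsymbol G)$ into
  $|J|\nabla\xi\cdot(\boldsymbol F,\boldsymbol G)$ (\<open>edge_flux_freestream\<close>). This is the trace of
  the local flux at the flux points, and therefore, again by exactness of interpolation, along the
  whole edge (\<open>num_flux_freestream\<close>).

  Exactness of interpolation rests on the Legendre polynomial of degree $n$ having $n$ distinct
  roots (\<open>legendre_roots\<close>). They also have to lie in $[-1,1]$, since a freestream
  prescribes the states only there.

  For the conservative formulas there is nothing new to prove: by the product rule and the symmetry
  of mixed partials the curl forms are the same functions as the products of coordinate derivatives,
  for every weight of the two forms and every time
  (\<open>conservative_eq_nonconservative\<close>).
\<close>

section \<open>Gauss--Legendre points\<close>

text \<open>Consecutive roots are separated by a root of the derivative. Adding the roots in increasing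
  order, each new one contributes a point beyond the previous maximum, so the points found are
  distinct.\<close>

lemma rolle_roots:
  fixes p :: "real poly"
  assumes "finite S" "S \<noteq> {}" "\<forall>s\<in>S. poly p s = 0"
  shows "\<exists>T. finite T \<and> card T = card S - 1 \<and> T \<subseteq> {Min S<..<Max S} \<and> (\<forall>t\<in>T. poly (pderiv p) t = 0)"
  using assms
proof (induction S rule: finite_linorder_max_induct)
  case empty
  then show ?case by simp
next
  case (insert b A)
  show ?case
  proof (cases "A = {}")
    case True
    then show ?thesis by (intro exI[of _ "{}"]) auto
  next
    case False
    then obtain T where T: "finite T" "card T = card A - 1" "T \<subseteq> {Min A<..<Max A}"
        "\<forall>t\<in>T. poly (pderiv p) t = 0"
      using insert.IH insert.prems by auto
    have less: "Max A < b" using insert.hyps False by simp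
    obtain z where z: "Max A < z" "z < b" "poly p b - poly p (Max A) = (b - Max A) * poly (pderiv p) z"
      using poly_MVT[OF less] by blast
    have root: "poly (pderiv p) z = 0"
      using z less insert.prems insert.hyps(1) False by simp
    have bounds: "Min (insert b A) = Min A" "Max (insert b A) = b"
      using less insert.hyps False by (auto intro!: min_absorb2 max_absorb1 less_imp_le)
    have "Min A \<le> Max A" using insert.hyps(1) False by simp
    moreover have "b \<notin> A" using insert.hyps by blast
    moreover have "z \<notin> T" using T(3) z(1) by auto
    moreover have "card A \<ge> 1" using insert.hyps(1) False by (simp add: Suc_le_eq card_gt_0_iff)
    moreover have "insert z T \<subseteq> {Min A<..<b}"
      using T(3) z(1,2) less \<open>Min A \<le> Max A\<close> by fastforce
    ultimately show ?thesis using T z root insert.hyps(1) unfolding bounds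
      by (intro exI[of _ "insert z T"]) auto
  qed
qed

lemma linear_power_dvd_pderiv:
  fixes p :: "real poly"
  assumes "[:a, 1:] ^ Suc m dvd p"
  shows "[:a, 1:] ^ m dvd pderiv p"
proof -
  obtain q where p: "p = [:a, 1:] ^ Suc m * q" using assms by blast
  have "pderiv p = [:a, 1:] ^ Suc m * pderiv q + smult (of_nat (Suc m)) ([:a, 1:] ^ m) * q"
    unfolding p pderiv_mult pderiv_power_Suc by (simp add: pderiv_pCons algebra_simps)
  also have "\<dots> = [:a, 1:] ^ m * ([:a, 1:] * pderiv q + smult (of_nat (Suc m)) q)"
    by (simp add: algebra_simps)
  finally show ?thesis by simp
qed

text \<open>The classical count of the roots of the Legendre polynomial. Each derivative lowers the order of
  vanishing of $(s^2-1)^n$ at $\pm 1$ by one; while that order is positive, the two endpoints can be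
  added to the interior roots, and Rolle's theorem gives one more interior root than before. The
  two divisibility claims carry the order at the endpoints through the induction.\<close>

lemma rodrigues_derivative_roots:
  assumes "j \<le> n"
  shows "[:-1, 1:] ^ (n - j) dvd (pderiv ^^ j) ([:-1, 0, 1:] ^ n :: real poly)
       \<and> [:1, 1:] ^ (n - j) dvd (pderiv ^^ j) ([:-1, 0, 1:] ^ n :: real poly)
       \<and> (\<exists>S. finite S \<and> card S = j \<and> S \<subseteq> {-1<..<1}
            \<and> (\<forall>s\<in>S. poly ((pderiv ^^ j) ([:-1, 0, 1:] ^ n)) s = (0::real)))"
  using assms
proof (induction j)
  case 0
  have "[:-1, 0, 1:] = [:-1, 1:] * [:1, 1 :: real:]" by simp
  then have "[:-1, 0, 1:] ^ n = [:-1, 1:] ^ n * [:1, 1 :: real:] ^ n"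
    by (metis power_mult_distrib)
  then show ?case by (auto intro: exI[of _ "{}"])
next
  case (Suc j)
  define p :: "real poly" where "p = (pderiv ^^ j) ([:-1, 0, 1:] ^ n)"
  have diff: "n - j = Suc (n - Suc j)" using Suc.prems by simp
  obtain S where S: "finite S" "card S = j" "S \<subseteq> {-1<..<1}" "\<forall>s\<in>S. poly p s = 0"
    using Suc p_def by auto
  have dvd: "[:-1, 1:] ^ Suc (n - Suc j) dvd p" "[:1, 1:] ^ Suc (n - Suc j) dvd p"
    using Suc unfolding p_def diff[symmetric] by auto
  have "[:-1, 1:] dvd p" "[:1, 1:] dvd p"
    using dvd by (auto simp only: power_Suc dest: dvd_mult_left)
  then have ends: "poly p 1 = 0" "poly p (-1) = 0"
    by (simp_all add: poly_eq_0_iff_dvd)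
  let ?S = "insert (-1) (insert 1 S)"
  have "1 \<notin> S" "-1 \<notin> S" using S(3) by auto
  then have card: "card ?S = j + 2" using S by simp
  have "Max ?S = 1" "Min ?S = -1"
    by (rule Max_eqI Min_eqI; use S in fastforce)+
  then obtain T where "finite T" "card T = Suc j" "T \<subseteq> {-1<..<1}" "\<forall>t\<in>T. poly (pderiv p) t = 0"
    using rolle_roots[of ?S p] S ends card by auto
  moreover have "[:-1, 1:] ^ (n - Suc j) dvd pderiv p" "[:1, 1:] ^ (n - Suc j) dvd pderiv p"
    using dvd linear_power_dvd_pderiv by blast+
  ultimately show ?case unfolding funpow.simps comp_def p_def[symmetric] by blast
qed

text \<open>The \<open>n\<close> interior roots supplied by Rolle's theorem exhaust the roots, as the degree
  is \<open>n\<close>.\<close>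

lemma legendre_roots:
  "finite {s. poly (legendre_poly n) s = 0}" (is "finite ?R")
  "card {s. poly (legendre_poly n) s = 0} = n"
  "{s. poly (legendre_poly n) s = 0} \<subseteq> {-1<..<1}"
proof -
  define q :: "real poly" where "q = (pderiv ^^ n) ([:-1, 0, 1:] ^ n)"
  have h: "degree ((pderiv ^^ i) p) = degree p - i" for i and p :: "real poly"
    by (induction i) (auto simp: degree_pderiv)
  (* Rodrigues' formula yields a nonzero polynomial: a derivative vanishes only when the
     polynomial is constant, and the i-th derivative still has degree 2 n - i. *)
  have nz: "(pderiv ^^ i) ([:-1, 0, 1 :: real:] ^ n) \<noteq> 0" if "i \<le> n" for i
    using that
  proof (induction i)
    case (Suc i)
    show ?case
    proof
      assume "(pderiv ^^ Suc i) ([:-1, 0, 1 :: real:] ^ n) = 0"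
      then have "degree ((pderiv ^^ i) ([:-1, 0, 1 :: real:] ^ n)) = 0"
        by (simp add: pderiv_eq_0_iff)
      then show False using Suc.prems by (simp add: h degree_power_eq)
    qed
  qed simp
  have q: "q \<noteq> 0" "degree q = n"
    using nz[of n] h[of n] by (auto simp: q_def degree_power_eq)
  have R: "?R = {s. poly q s = 0}"
    unfolding legendre_poly_def q_def by simp
  obtain S where S: "finite S" "card S = n" "S \<subseteq> {-1<..<1}" "\<forall>s\<in>S. poly q s = 0"
    using rodrigues_derivative_roots[of n n] q_def by auto
  show fin: "finite ?R" unfolding R using poly_roots_finite[OF q(1)] .
  have "card ?R \<le> n" unfolding R using card_poly_roots_bound[OF q(1)] q(2) by simp
  then have "S = ?R"
    using S by (intro card_seteq fin) (auto simp: R)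
  then show "card ?R = n" "?R \<subseteq> {-1<..<1}" using S by auto
qed

lemma gauss_pts:
  "inj_on (gauss_pt n) {..<n}"
  "i < n \<Longrightarrow> gauss_pt n i \<in> {-1..1}"
proof -
  let ?xs = "sorted_list_of_set {s. poly (legendre_poly n) s = 0}"
  have len: "length ?xs = n" using legendre_roots(2) by simp
  show "inj_on (gauss_pt n) {..<n}"
    by (rule inj_onI) (use nth_eq_iff_index_eq[of ?xs] in \<open>simp add: gauss_pt_def legendre_roots(2)\<close>)
  assume "i < n"
  then have "?xs ! i \<in> set ?xs" using len by simp
  then show "gauss_pt n i \<in> {-1..1}"
    using legendre_roots[of n] unfolding gauss_pt_def by auto
qed

section \<open>Exactness of interpolation\<close>

lemma lagrange_at_gauss_pt:
  assumes "i < n" "m < n"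
  shows "poly (lagrange n i) (gauss_pt n m) = (if m = i then 1 else 0)"
proof -
  have "gauss_pt n i \<noteq> gauss_pt n r" if "r \<in> {..<n} - {i}" for r
    using that assms(1) gauss_pts(1)[of n] by (auto simp: inj_on_def)
  then show ?thesis using assms
    by (auto simp: lagrange_def poly_prod diff_divide_distrib[symmetric] intro!: prod.neutral bexI[of _ m])
qed

text \<open>Both sides are polynomials of degree below \<open>n\<close> that agree at the \<open>n\<close> distinct Gauss points.\<close>

lemma lagrange_interpolation:
  assumes "degree p < n"
  shows "(\<Sum>i<n. poly (lagrange n i) s * poly p (gauss_pt n i)) = poly p s"
proof -
  let ?L = "\<Sum>i<n. smult (poly p (gauss_pt n i)) (lagrange n i)"
  have "degree ?L \<le> n - 1"
    by (rule degree_sum_le) (auto intro!: order.trans[OF degree_smult_le] degree_lagrange simp del: One_nat_def)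
  moreover have "card (gauss_pt n ` {..<n}) = n"
    by (simp add: card_image gauss_pts)
  moreover have "poly ?L t = poly p t" if "t \<in> gauss_pt n ` {..<n}" for t
    using that by (auto simp: poly_sum lagrange_at_gauss_pt if_distrib[of "(*) _"] cong: if_cong)
  ultimately have "?L = p"
    using assms by (intro poly_eqI_degree[of "gauss_pt n ` {..<n}"]) auto
  then have "poly p s = poly ?L s" by simp
  then show ?thesis by (simp add: poly_sum mult.commute)
qed

lemma tensor_poly_slice_xi:
  assumes "f \<in> tensor_poly a b"
  obtains p where "degree p \<le> a" "\<And>\<xi>. f \<xi> \<eta> = poly p \<xi>"
proof -
  obtain c where c: "\<And>\<xi> \<eta>. f \<xi> \<eta> = (\<Sum>i\<le>a. \<Sum>j\<le>b. c i j * \<xi> ^ i * \<eta> ^ j)"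
    using assms unfolding tensor_poly_def by blast
  show ?thesis
  proof (rule that)
    show "degree (\<Sum>i\<le>a. monom (\<Sum>j\<le>b. c i j * \<eta> ^ j) i) \<le> a"
      by (rule degree_sum_le) (auto intro: order.trans[OF degree_monom_le])
  qed (simp add: c poly_sum poly_monom sum_distrib_left sum_distrib_right mult_ac)
qed

lemma tensor_poly_slice_eta:
  assumes "f \<in> tensor_poly a b"
  obtains p where "degree p \<le> b" "\<And>\<eta>. f \<xi> \<eta> = poly p \<eta>"
proof -
  obtain c where c: "\<And>\<xi> \<eta>. f \<xi> \<eta> = (\<Sum>i\<le>a. \<Sum>j\<le>b. c i j * \<xi> ^ i * \<eta> ^ j)"
    using assms unfolding tensor_poly_def by blast
  show ?thesis
  proof (rule that)
    show "degree (\<Sum>j\<le>b. monom (\<Sum>i\<le>a. c i j * \<xi> ^ i) j) \<le> b"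
      by (rule degree_sum_le) (auto intro: order.trans[OF degree_monom_le])
    show "f \<xi> \<eta> = poly (\<Sum>j\<le>b. monom (\<Sum>i\<le>a. c i j * \<xi> ^ i) j) \<eta>" for \<eta>
      unfolding c poly_sum by (subst sum.swap) (simp add: poly_monom sum_distrib_right)
  qed
qed

lemma interpolation_slice_xi:
  assumes "f \<in> tensor_poly a b" "a < n"
  shows "(\<Sum>i<n. poly (lagrange n i) \<xi> * f (gauss_pt n i) \<eta>) = f \<xi> \<eta>"
  by (rule tensor_poly_slice_xi[OF assms(1), of \<eta>]) (use assms(2) in \<open>simp add: lagrange_interpolation\<close>)

lemma interpolation_slice_eta:
  assumes "f \<in> tensor_poly a b" "b < n"
  shows "(\<Sum>j<n. poly (lagrange n j) \<eta> * f \<xi> (gauss_pt n j)) = f \<xi> \<eta>"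
  by (rule tensor_poly_slice_eta[OF assms(1), of \<xi>]) (use assms(2) in \<open>simp add: lagrange_interpolation\<close>)

lemma tensor_interpolation:
  assumes "f \<in> tensor_poly a b" "a < n" "b < n"
  shows "(\<Sum>i<n. \<Sum>j<n. tensor_lagrange n i j \<xi> \<eta> * f (gauss_pt n i) (gauss_pt n j)) = f \<xi> \<eta>"
proof -
  have "(\<Sum>i<n. \<Sum>j<n. tensor_lagrange n i j \<xi> \<eta> * f (gauss_pt n i) (gauss_pt n j))
      = (\<Sum>i<n. poly (lagrange n i) \<xi> * (\<Sum>j<n. poly (lagrange n j) \<eta> * f (gauss_pt n i) (gauss_pt n j)))"
    by (simp add: tensor_lagrange_def sum_distrib_left mult_ac)
  then show ?thesis
    by (simp add: interpolation_slice_eta[OF assms(1,3)] interpolation_slice_xi[OF assms(1,2)])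
qed

section \<open>Partial derivatives of tensor-product polynomials\<close>

lemma tensor_poly_deriv_xi:
  assumes "f \<in> tensor_poly a b"
  shows "((\<lambda>s. f s \<eta>) has_real_derivative d_xi f \<xi> \<eta>) (at \<xi>)"
  by (rule tensor_poly_slice_xi[OF assms, of \<eta>])
     (simp add: d_xi_def DERIV_deriv_iff_real_differentiable field_differentiable_imp_differentiable)

lemma tensor_poly_deriv_eta:
  assumes "f \<in> tensor_poly a b"
  shows "((\<lambda>s. f \<xi> s) has_real_derivative d_eta f \<xi> \<eta>) (at \<eta>)"
  by (rule tensor_poly_slice_eta[OF assms, of \<xi>])
     (simp add: d_eta_def DERIV_deriv_iff_real_differentiable)

lemma tensor_poly_partials:
  assumes "f \<in> tensor_poly a b"
  shows "d_xi f \<in> tensor_poly a b" "d_eta f \<in> tensor_poly a b"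
    "d_xi (d_eta f) \<xi> \<eta> = d_eta (d_xi f) \<xi> \<eta>"
proof -
  obtain c where c: "\<And>\<xi> \<eta>. f \<xi> \<eta> = (\<Sum>i\<le>a. \<Sum>j\<le>b. c i j * \<xi> ^ i * \<eta> ^ j)"
    using assms unfolding tensor_poly_def by blast
  have xi: "d_xi f = (\<lambda>\<xi> \<eta>. \<Sum>i\<le>a. \<Sum>j\<le>b. c i j * (of_nat i * \<xi> ^ (i - 1)) * \<eta> ^ j)"
    unfolding d_xi_def c
    by (intro ext DERIV_imp_deriv) (auto intro!: derivative_eq_intros sum.cong)
  have eta: "d_eta f = (\<lambda>\<xi> \<eta>. \<Sum>i\<le>a. \<Sum>j\<le>b. c i j * \<xi> ^ i * (of_nat j * \<eta> ^ (j - 1)))"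
    unfolding d_eta_def c
    by (intro ext DERIV_imp_deriv) (auto intro!: derivative_eq_intros sum.cong)
  show "d_xi f \<in> tensor_poly a b" unfolding xi
    by (intro tensor_poly_sum, rule tensor_polyI[where p = "smult (c _ _) (monom (of_nat _) (_ - 1))" and q = "monom 1 _"])
       (auto simp: poly_monom degree_monom_eq intro!: order.trans[OF degree_smult_le] order.trans[OF degree_monom_le])
  show "d_eta f \<in> tensor_poly a b" unfolding eta
    by (intro tensor_poly_sum, rule tensor_polyI[where p = "smult (c _ _) (monom 1 _)" and q = "monom (of_nat _) (_ - 1)"])
       (auto simp: poly_monom degree_monom_eq intro!: order.trans[OF degree_smult_le] order.trans[OF degree_monom_le])
  have "d_xi (d_eta f) \<xi> \<eta> = (\<Sum>i\<le>a. \<Sum>j\<le>b. c i j * (of_nat i * \<xi> ^ (i - 1)) * (of_nat j * \<eta> ^ (j - 1)))"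
    unfolding eta unfolding d_xi_def
    by (intro DERIV_imp_deriv) (auto intro!: derivative_eq_intros sum.cong)
  moreover have "d_eta (d_xi f) \<xi> \<eta> = (\<Sum>i\<le>a. \<Sum>j\<le>b. c i j * (of_nat i * \<xi> ^ (i - 1)) * (of_nat j * \<eta> ^ (j - 1)))"
    unfolding xi unfolding d_eta_def
    by (intro DERIV_imp_deriv) (auto intro!: derivative_eq_intros sum.cong)
  ultimately show "d_xi (d_eta f) \<xi> \<eta> = d_eta (d_xi f) \<xi> \<eta>" by simp
qed

lemma tensor_poly_minus:
  assumes "f \<in> tensor_poly a b"
  shows "(\<lambda>\<xi> \<eta>. - f \<xi> \<eta>) \<in> tensor_poly a b"
proof -
  obtain c where "\<And>\<xi> \<eta>. f \<xi> \<eta> = (\<Sum>i\<le>a. \<Sum>j\<le>b. c i j * \<xi> ^ i * \<eta> ^ j)"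
    using assms unfolding tensor_poly_def by blast
  then show ?thesis unfolding tensor_poly_def mem_Collect_eq
    by (intro exI[of _ "\<lambda>i j. - c i j"]) (simp add: sum_negf)
qed

lemma d_xi_minus:
  assumes "f \<in> tensor_poly a b"
  shows "d_xi (\<lambda>\<xi> \<eta>. - f \<xi> \<eta>) \<xi> \<eta> = - d_xi f \<xi> \<eta>"
  unfolding d_xi_def[of "\<lambda>\<xi> \<eta>. - f \<xi> \<eta>"]
  by (intro DERIV_imp_deriv DERIV_minus tensor_poly_deriv_xi[OF assms])

lemma d_eta_minus:
  assumes "f \<in> tensor_poly a b"
  shows "d_eta (\<lambda>\<xi> \<eta>. - f \<xi> \<eta>) \<xi> \<eta> = - d_eta f \<xi> \<eta>"
  unfolding d_eta_def[of "\<lambda>\<xi> \<eta>. - f \<xi> \<eta>"]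
  by (intro DERIV_imp_deriv DERIV_minus tensor_poly_deriv_eta[OF assms])

section \<open>Metrics\<close>

text \<open>With $t=\tau$ the factors $T_\tau = 1$, $T_\xi = T_\eta = 0$ and $X_\tau = Y_\tau = 0$ reduce
  each of the four curl forms to a single coordinate derivative; for the Jacobian the second-order
  terms cancel by the symmetry of mixed partials. Since the records themselves are equal, every
  statement about the scheme transfers.\<close>

lemma conservative_eq_nonconservative:
  assumes x: "x \<in> tensor_poly a b" and y: "y \<in> tensor_poly a b"
  shows "conservative_metrics \<theta> \<tau> x y = nonconservative_metrics x y"
proof -
  have xi: "deriv (\<lambda>s. f s \<eta> * g s \<eta>) \<xi> = d_xi f \<xi> \<eta> * g \<xi> \<eta> + f \<xi> \<eta> * d_xi g \<xi> \<eta>"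
    if "f \<in> tensor_poly a b" "g \<in> tensor_poly a b" for f g \<xi> \<eta>
    using DERIV_mult[OF that[THEN tensor_poly_deriv_xi, of \<eta> \<xi>]]
    by (intro DERIV_imp_deriv) (simp add: mult_ac add_ac)
  have eta: "deriv (\<lambda>s. f \<xi> s * g \<xi> s) \<eta> = d_eta f \<xi> \<eta> * g \<xi> \<eta> + f \<xi> \<eta> * d_eta g \<xi> \<eta>"
    if "f \<in> tensor_poly a b" "g \<in> tensor_poly a b" for f g \<xi> \<eta>
    using DERIV_mult[OF that[THEN tensor_poly_deriv_eta, of \<xi> \<eta>]]
    by (intro DERIV_imp_deriv) (simp add: mult_ac add_ac)
  have lin: "deriv (\<lambda>s. c * s) t = c" "deriv (\<lambda>s. s * c) t = c" "deriv (\<lambda>s. s) t = 1" for c t :: real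
    by (auto intro!: DERIV_imp_deriv derivative_eq_intros)
  have xi_fold: "deriv (\<lambda>s. f s \<eta>) \<xi> = d_xi f \<xi> \<eta>" and eta_fold: "deriv (f \<xi>) \<eta> = d_eta f \<xi> \<eta>"
    if "f \<in> tensor_poly a b" for f \<xi> \<eta> by (simp_all add: d_xi_def d_eta_def)
  note P = tensor_poly_partials
  show ?thesis
    unfolding conservative_metrics_def nonconservative_metrics_def Let_def
    by (auto simp: curl_form_def mult3_def D_xi_def D_eta_def D_tau_def xi_fold eta_fold lin
        xi eta x y P(1,2)[OF x] P(1,2)[OF y] P(3)[OF x] P(3)[OF y] algebra_simps intro!: ext)
qed


section \<open>Interface fluxes in a freestream\<close>

lemma planar_orthogonal_parallel:
  fixes d t \<nu> :: "real \<times> real"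
  assumes "\<nu> \<bullet> t = 0" "d \<bullet> t = 0" "t \<noteq> 0" "d \<noteq> 0"
  obtains c where "\<nu> = c *\<^sub>R d"
proof -
  obtain a b p q u v where e: "\<nu> = (a, b)" "t = (p, q)" "d = (u, v)" by (metis surj_pair)
  have "a * p + b * q = 0" "u * p + v * q = 0" using assms(1,2) e by (auto simp: inner_prod_def)
  then have "(a * v - b * u) * p = 0" "(a * v - b * u) * q = 0" by algebra+
  then have cross: "a * v = b * u" using assms(3) e by (auto simp: zero_prod_def)
  show ?thesis
  proof (cases "u = 0")
    case True
    then have "v \<noteq> 0" using assms(4) e by (auto simp: zero_prod_def)
    then show ?thesis using cross True e by (intro that[of "b / v"]) auto
  next
    case False
    then show ?thesis using cross e by (intro that[of "a / u"]) (auto simp: field_simps)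
  qed
qed

text \<open>In the plane the vectors orthogonal to the tangent \<open>t\<close> form a line, here spanned by \<open>d\<close>. Unit length
  and the outward direction \<open>w\<close> then single out one of its points, which is needed because the outward
  normal is a definite description.\<close>

lemma the_unit_normal:
  fixes d t w :: "real \<times> real"
  assumes "d \<bullet> t = 0" "t \<noteq> 0" "d \<bullet> w \<noteq> 0"
  shows "(THE \<nu>. norm \<nu> = 1 \<and> \<nu> \<bullet> t = 0 \<and> \<nu> \<bullet> w > 0) = (sgn (d \<bullet> w) / norm d) *\<^sub>R d"
proof (rule the_equality)
  have d: "d \<noteq> 0" using assms(3) by auto
  then show "norm ((sgn (d \<bullet> w) / norm d) *\<^sub>R d) = 1
      \<and> (sgn (d \<bullet> w) / norm d) *\<^sub>R d \<bullet> t = 0 \<and> (sgn (d \<bullet> w) / norm d) *\<^sub>R d \<bullet> w > 0"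
    using assms by (auto simp: sgn_if divide_neg_pos mult_neg_neg)
  fix \<nu> assume \<nu>: "norm \<nu> = 1 \<and> \<nu> \<bullet> t = 0 \<and> \<nu> \<bullet> w > 0"
  obtain c where c: "\<nu> = c *\<^sub>R d"
    using planar_orthogonal_parallel[of \<nu> t d] \<nu> assms d by blast
  have abs: "\<bar>c\<bar> = 1 / norm d" using \<nu> d unfolding c by (simp add: field_simps)
  have "c * (d \<bullet> w) > 0" using \<nu> unfolding c by simp
  then have "sgn c = sgn (d \<bullet> w)" by (auto simp: zero_less_mult_iff)
  then have "c = sgn (d \<bullet> w) / norm d"
    using abs by (metis mult_sgn_abs times_divide_eq_right mult.right_neutral)
  then show "\<nu> = (sgn (d \<bullet> w) / norm d) *\<^sub>R d" using c by simp
qed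

text \<open>The reason for the factor $\|\nabla\xi\|\,\mathrm{sign}(\boldsymbol n\cdot\nabla\xi)$ in the
  numerical flux: it recovers $\nabla\xi$ from the unit normal, whichever way the normal points.\<close>

lemma unit_normal_scaled:
  fixes d t w :: "real \<times> real"
  assumes "d \<bullet> t = 0" "t \<noteq> 0" "d \<bullet> w \<noteq> 0"
    and \<nu>: "\<nu> = (THE \<nu>. norm \<nu> = 1 \<and> \<nu> \<bullet> t = 0 \<and> \<nu> \<bullet> w > 0)"
  shows "(norm d * sgn (\<nu> \<bullet> d)) *\<^sub>R \<nu> = d"
proof -
  have d: "norm d > 0" using assms(3) by auto
  have e: "\<nu> = (sgn (d \<bullet> w) / norm d) *\<^sub>R d"
    unfolding \<nu> by (rule the_unit_normal[OF assms(1-3)])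
  have "\<nu> \<bullet> d = sgn (d \<bullet> w) * norm d"
    unfolding e using d by (simp add: dot_square_norm power2_eq_square)
  then have "sgn (\<nu> \<bullet> d) = sgn (d \<bullet> w)" using d by (simp add: sgn_mult)
  then show ?thesis unfolding e using d assms(3) by (auto simp: sgn_if)
qed

text \<open>The pair \<open>(edge_metric_x, edge_metric_y)\<close> is $|J|\nabla\xi$ on the vertical and
  $|J|\nabla\eta$ on the horizontal edges of the reference square; with it, one argument
  covers all four edges.\<close>

fun edge_metric_x :: "metrics \<Rightarrow> edge \<Rightarrow> real \<Rightarrow> real" where
  "edge_metric_x m West s = Jxi_x m (-1) s"
| "edge_metric_x m East s = Jxi_x m 1 s"
| "edge_metric_x m South s = Jeta_x m s (-1)"
| "edge_metric_x m North s = Jeta_x m s 1"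

fun edge_metric_y :: "metrics \<Rightarrow> edge \<Rightarrow> real \<Rightarrow> real" where
  "edge_metric_y m West s = Jxi_y m (-1) s"
| "edge_metric_y m East s = Jxi_y m 1 s"
| "edge_metric_y m South s = Jeta_y m s (-1)"
| "edge_metric_y m North s = Jeta_y m s 1"

text \<open>For equal states the Lax--Friedrichs dissipation drops out, and the normal flux is linear in the
  normal, so the scaling factor can be moved onto the normal. That $\nabla\xi$ is
  orthogonal to the tangent and transversal to the outward direction comes from
  $\nabla\xi\cdot(x_\eta,y_\eta)=0$ and $\nabla\xi\cdot(x_\xi,y_\xi)=1$, and likewise for
  $\nabla\eta$.\<close>

lemma edge_flux_freestream:
  fixes F G :: "real^'v \<Rightarrow> real^'v"
  assumes J: "\<forall>\<xi>\<in>{-1..1}. \<forall>\<eta>\<in>{-1..1}.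
           d_xi x \<xi> \<eta> * d_eta y \<xi> \<eta> - d_eta x \<xi> \<eta> * d_xi y \<xi> \<eta> \<noteq> 0"
    and fs: "freestream k Q Qh Qx" and s: "s \<in> {-1..1}"
    and m: "m = nonconservative_metrics x y"
  shows "edge_flux x y m F G \<alpha> Qh Qx e s = edge_metric_x m e s *\<^sub>R F Q + edge_metric_y m e s *\<^sub>R G Q"
proof -
  define p where "p = edge_pt e s"
  define d where "d = edge_nabla m e s"
  define \<nu> where "\<nu> = outward_unit_normal x y e s"
  define jac where "jac = Jac m (fst p) (snd p)"
  have p: "fst p \<in> {-1..1}" "snd p \<in> {-1..1}" using s by (cases e; simp add: p_def)+
  have jac: "jac \<noteq> 0" "jac = d_xi x (fst p) (snd p) * d_eta y (fst p) (snd p)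
      - d_eta x (fst p) (snd p) * d_xi y (fst p) (snd p)"
    using J p by (auto simp: jac_def m nonconservative_metrics_def)
  have orth: "d \<bullet> edge_tangent x y e s = 0"
    by (cases e; simp add: d_def m nonconservative_metrics_def nabla_xi_def nabla_eta_def
        phys_xi_def phys_eta_def inner_prod_def mult.commute)
  have tang: "edge_tangent x y e s \<noteq> 0"
    using jac by (cases e; auto simp: p_def phys_xi_def phys_eta_def zero_prod_def)
  have d: "jac * fst d = edge_metric_x m e s" "jac * snd d = edge_metric_y m e s"
    using jac(1) by (cases e; simp add: d_def jac_def p_def nabla_xi_def nabla_eta_def)+
  (* Multiplying by the Jacobian clears the denominators in the gradient: what remains is
     plus or minus the determinant. *)
  have "jac * (d \<bullet> edge_outward x y e s)
      = edge_metric_x m e s * fst (edge_outward x y e s) + edge_metric_y m e s * snd (edge_outward x y e s)"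
    unfolding d[symmetric] by (simp add: inner_prod_def algebra_simps)
  also have "\<bar>\<dots>\<bar> = \<bar>jac\<bar>"
    unfolding jac(2)
    by (cases e; simp add: p_def m nonconservative_metrics_def phys_xi_def phys_eta_def algebra_simps)
  finally have out: "d \<bullet> edge_outward x y e s \<noteq> 0" using jac(1) by auto
  have scaled: "(norm d * sgn (\<nu> \<bullet> d)) *\<^sub>R \<nu> = d"
    by (rule unit_normal_scaled[OF orth tang out]) (simp add: \<nu>_def outward_unit_normal_def)
  have "Qh (fst p) (snd p) = Q" "Qx e s = Q" using fs p s unfolding freestream_def by auto
  then have "edge_flux x y m F G \<alpha> Qh Qx e s = (jac * norm d * sgn (\<nu> \<bullet> d)) *\<^sub>R normal_flux F G \<nu> Q"
    unfolding edge_flux_def Let_def lax_friedrichs_def jac_def d_def \<nu>_def p_def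
    by (simp add: scaleR_2[symmetric])
  also have "\<dots> = jac *\<^sub>R normal_flux F G ((norm d * sgn (\<nu> \<bullet> d)) *\<^sub>R \<nu>) Q"
    by (simp add: normal_flux_def scaleR_add_right mult_ac)
  also have "\<dots> = edge_metric_x m e s *\<^sub>R F Q + edge_metric_y m e s *\<^sub>R G Q"
    unfolding scaled by (simp add: normal_flux_def scaleR_add_right d)
  finally show ?thesis .
qed

section \<open>The residual in a freestream\<close>

lemma loc_flux_freestream:
  fixes F G :: "real^'v \<Rightarrow> real^'v"
  assumes fs: "freestream k Q Qh Qx" and ab: "a < n" "b < n"
  shows "Jxi_x m \<in> tensor_poly a b \<Longrightarrow> Jxi_y m \<in> tensor_poly a b \<Longrightarrow>
      F_loc n m F G Qh \<xi> \<eta> = Jxi_x m \<xi> \<eta> *\<^sub>R F Q + Jxi_y m \<xi> \<eta> *\<^sub>R G Q"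
    and "Jeta_x m \<in> tensor_poly a b \<Longrightarrow> Jeta_y m \<in> tensor_poly a b \<Longrightarrow>
      G_loc n m F G Qh \<xi> \<eta> = Jeta_x m \<xi> \<eta> *\<^sub>R F Q + Jeta_y m \<xi> \<eta> *\<^sub>R G Q"
proof -
  have Q: "Qh (gauss_pt n i) (gauss_pt n j) = Q" if "i < n" "j < n" for i j
    using fs gauss_pts(2) that unfolding freestream_def by blast
  have I: "(\<Sum>i<n. \<Sum>j<n. tensor_lagrange n i j \<xi> \<eta> *\<^sub>R (f (gauss_pt n i) (gauss_pt n j) *\<^sub>R A
        + g (gauss_pt n i) (gauss_pt n j) *\<^sub>R B)) = f \<xi> \<eta> *\<^sub>R A + g \<xi> \<eta> *\<^sub>R B"
    if "f \<in> tensor_poly a b" "g \<in> tensor_poly a b" for f g and A B :: "real^'v"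
    unfolding tensor_interpolation[OF that(1) ab, of \<xi> \<eta>, symmetric]
      tensor_interpolation[OF that(2) ab, of \<xi> \<eta>, symmetric]
    by (simp add: scaleR_add_right sum.distrib scaleR_sum_left)
  show "F_loc n m F G Qh \<xi> \<eta> = Jxi_x m \<xi> \<eta> *\<^sub>R F Q + Jxi_y m \<xi> \<eta> *\<^sub>R G Q"
    if "Jxi_x m \<in> tensor_poly a b" "Jxi_y m \<in> tensor_poly a b"
    unfolding I[OF that, symmetric] F_loc_def Let_def by (intro sum.cong refl) (simp add: Q)
  show "G_loc n m F G Qh \<xi> \<eta> = Jeta_x m \<xi> \<eta> *\<^sub>R F Q + Jeta_y m \<xi> \<eta> *\<^sub>R G Q"
    if "Jeta_x m \<in> tensor_poly a b" "Jeta_y m \<in> tensor_poly a b"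
    unfolding I[OF that, symmetric] G_loc_def Let_def by (intro sum.cong refl) (simp add: Q)
qed

lemma vd_tensor_poly:
  fixes A B :: "real^'v"
  assumes "f \<in> tensor_poly a b" "g \<in> tensor_poly a b"
  shows "vd_xi (\<lambda>\<xi> \<eta>. f \<xi> \<eta> *\<^sub>R A + g \<xi> \<eta> *\<^sub>R B) \<xi> \<eta> = d_xi f \<xi> \<eta> *\<^sub>R A + d_xi g \<xi> \<eta> *\<^sub>R B"
    and "vd_eta (\<lambda>\<xi> \<eta>. f \<xi> \<eta> *\<^sub>R A + g \<xi> \<eta> *\<^sub>R B) \<xi> \<eta> = d_eta f \<xi> \<eta> *\<^sub>R A + d_eta g \<xi> \<eta> *\<^sub>R B"
  unfolding vd_xi_def vd_eta_def
  by (rule vector_derivative_at, rule derivative_eq_intros,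
      (rule has_vector_derivative_scaleR[OF tensor_poly_deriv_xi] has_vector_derivative_scaleR[OF tensor_poly_deriv_eta],
       rule assms, rule has_vector_derivative_const)+, simp)+

lemma metrics_tensor_poly:
  assumes x: "x \<in> tensor_poly l l" and y: "y \<in> tensor_poly l l"
    and m: "m = nonconservative_metrics x y"
  shows "Jxi_x m \<in> tensor_poly l l" "Jxi_y m \<in> tensor_poly l l"
    "Jeta_x m \<in> tensor_poly l l" "Jeta_y m \<in> tensor_poly l l"
  using tensor_poly_partials(1,2)[OF x] tensor_poly_partials(1,2)[OF y] tensor_poly_minus
  by (simp_all add: m nonconservative_metrics_def)

lemma metric_identities:
  assumes x: "x \<in> tensor_poly l l" and y: "y \<in> tensor_poly l l"
    and m: "m = nonconservative_metrics x y"
  shows "d_xi (Jxi_x m) \<xi> \<eta> + d_eta (Jeta_x m) \<xi> \<eta> = 0"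
    and "d_xi (Jxi_y m) \<xi> \<eta> + d_eta (Jeta_y m) \<xi> \<eta> = 0"
  by (simp_all add: m nonconservative_metrics_def d_xi_minus[OF tensor_poly_partials(2)[OF x]]
      d_eta_minus[OF tensor_poly_partials(1)[OF y]] tensor_poly_partials(3)[OF x] tensor_poly_partials(3)[OF y])

text \<open>Interpolation is the identity on these polynomials, so it commutes with differentiation.\<close>

lemma tensor_interpolation_partials:
  assumes "f \<in> tensor_poly a b" "a < n" "b < n"
  shows "(\<Sum>i<n. \<Sum>j<n. f (gauss_pt n i) (gauss_pt n j) * d_xi (tensor_lagrange n i j) \<xi> \<eta>) = d_xi f \<xi> \<eta>"
    and "(\<Sum>i<n. \<Sum>j<n. f (gauss_pt n i) (gauss_pt n j) * d_eta (tensor_lagrange n i j) \<xi> \<eta>) = d_eta f \<xi> \<eta>"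
proof -
  have f: "f = (\<lambda>\<xi> \<eta>. \<Sum>i<n. \<Sum>j<n. f (gauss_pt n i) (gauss_pt n j) * tensor_lagrange n i j \<xi> \<eta>)"
    using tensor_interpolation[OF assms] by (simp add: mult.commute)
  have L: "tensor_lagrange n i j \<in> tensor_poly (n - 1) (n - 1)" if "i < n" "j < n" for i j
    using tensor_lagrange_degree[OF that, of 1] by simp
  show "(\<Sum>i<n. \<Sum>j<n. f (gauss_pt n i) (gauss_pt n j) * d_xi (tensor_lagrange n i j) \<xi> \<eta>) = d_xi f \<xi> \<eta>"
    by (subst (2) f, subst (2) d_xi_def, rule DERIV_imp_deriv[symmetric])
       (intro DERIV_sum DERIV_cmult tensor_poly_deriv_xi[OF L]; simp)
  show "(\<Sum>i<n. \<Sum>j<n. f (gauss_pt n i) (gauss_pt n j) * d_eta (tensor_lagrange n i j) \<xi> \<eta>) = d_eta f \<xi> \<eta>"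
    by (subst (2) f, subst (2) d_eta_def, rule DERIV_imp_deriv[symmetric])
       (intro DERIV_sum DERIV_cmult tensor_poly_deriv_eta[OF L]; simp)
qed

text \<open>Along an edge the numerical flux interpolates the exact scaled flux, which is a polynomial of
  degree at most \<open>l\<close> in the edge parameter and is therefore reproduced. At the edge, this is the
  value of the local flux, so the flux corrections vanish.\<close>

lemma num_flux_freestream:
  fixes F G :: "real^'v \<Rightarrow> real^'v"
  assumes x: "x \<in> tensor_poly l l" and y: "y \<in> tensor_poly l l"
    and J: "\<forall>\<xi>\<in>{-1..1}. \<forall>\<eta>\<in>{-1..1}.
           d_xi x \<xi> \<eta> * d_eta y \<xi> \<eta> - d_eta x \<xi> \<eta> * d_xi y \<xi> \<eta> \<noteq> 0"
    and fs: "freestream k Q Qh Qx" and "l < n"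
    and m: "m = nonconservative_metrics x y"
  shows "num_flux n x y m F G \<alpha> Qh Qx e s = edge_metric_x m e s *\<^sub>R F Q + edge_metric_y m e s *\<^sub>R G Q"
proof -
  note M = metrics_tensor_poly[OF x y m]
  have "(\<Sum>j<n. poly (lagrange n j) s * edge_metric_x m e (gauss_pt n j)) = edge_metric_x m e s"
    by (cases e; simp add: interpolation_slice_eta[OF M(1) \<open>l < n\<close>] interpolation_slice_xi[OF M(3) \<open>l < n\<close>])
  moreover have "(\<Sum>j<n. poly (lagrange n j) s * edge_metric_y m e (gauss_pt n j)) = edge_metric_y m e s"
    by (cases e; simp add: interpolation_slice_eta[OF M(2) \<open>l < n\<close>] interpolation_slice_xi[OF M(4) \<open>l < n\<close>])
  moreover have "num_flux n x y m F G \<alpha> Qh Qx e s =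
      (\<Sum>j<n. poly (lagrange n j) s * edge_metric_x m e (gauss_pt n j)) *\<^sub>R F Q
    + (\<Sum>j<n. poly (lagrange n j) s * edge_metric_y m e (gauss_pt n j)) *\<^sub>R G Q"
    unfolding num_flux_def
    by (simp add: edge_flux_freestream[OF J fs gauss_pts(2) m] scaleR_add_right sum.distrib scaleR_sum_left)
  ultimately show ?thesis by simp
qed

lemma nonconservative_GCL:
  fixes F G :: "real^'v \<Rightarrow> real^'v"
  assumes "l \<ge> 1" and x: "x \<in> tensor_poly l l" and y: "y \<in> tensor_poly l l"
    and J: "\<forall>\<xi>\<in>{-1..1}. \<forall>\<eta>\<in>{-1..1}.
           d_xi x \<xi> \<eta> * d_eta y \<xi> \<eta> - d_eta x \<xi> \<eta> * d_xi y \<xi> \<eta> \<noteq> 0"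
  shows "numerically_satisfies_GCL k l x y (nonconservative_metrics x y) F G \<alpha>"
proof -
  define m where "m = nonconservative_metrics x y"
  define n where "n = k + 2 * l"
  have ln: "l < n" using \<open>l \<ge> 1\<close> unfolding n_def by simp
  note M = metrics_tensor_poly[OF x y m_def]
  have "discrete_metric_identities n m"
    unfolding discrete_metric_identities_def
    by (simp add: tensor_interpolation_partials[OF M(1) ln ln] tensor_interpolation_partials[OF M(2) ln ln]
        tensor_interpolation_partials[OF M(3) ln ln] tensor_interpolation_partials[OF M(4) ln ln]
        metric_identities[OF x y m_def])
  moreover have "fr_residual n x y m F G \<alpha> Qh Qx \<xi> \<eta> = 0" if fs: "freestream k Q Qh Qx" for Q Qh Qx \<xi> \<eta>
  proof -
    have loc: "F_loc n m F G Qh = (\<lambda>\<xi> \<eta>. Jxi_x m \<xi> \<eta> *\<^sub>R F Q + Jxi_y m \<xi> \<eta> *\<^sub>R G Q)"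
      "G_loc n m F G Qh = (\<lambda>\<xi> \<eta>. Jeta_x m \<xi> \<eta> *\<^sub>R F Q + Jeta_y m \<xi> \<eta> *\<^sub>R G Q)"
      using loc_flux_freestream[OF fs ln ln] M by blast+
    have "F_cor n x y m F G \<alpha> Qh Qx = (\<lambda>\<xi> \<eta>. 0)" "G_cor n x y m F G \<alpha> Qh Qx = (\<lambda>\<xi> \<eta>. 0)"
      by (intro ext, simp add: F_cor_def G_cor_def loc num_flux_freestream[OF x y J fs ln m_def])+
    then have "delta_cor n x y m F G \<alpha> Qh Qx \<xi> \<eta> = 0"
      by (simp add: delta_cor_def vd_xi_def vd_eta_def)
    then have "fr_residual n x y m F G \<alpha> Qh Qx \<xi> \<eta>
        = (d_xi (Jxi_x m) \<xi> \<eta> + d_eta (Jeta_x m) \<xi> \<eta>) *\<^sub>R F Q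
        + (d_xi (Jxi_y m) \<xi> \<eta> + d_eta (Jeta_y m) \<xi> \<eta>) *\<^sub>R G Q"
      unfolding fr_residual_def loc vd_tensor_poly[OF M(1,2)] vd_tensor_poly[OF M(3,4)]
      by (simp add: scaleR_add_left)
    then show ?thesis by (simp add: metric_identities[OF x y m_def])
  qed
  ultimately show ?thesis
    unfolding numerically_satisfies_GCL_def freestream_preserving_def m_def n_def by blast
qed

theorem theorem2:
  fixes k l :: nat
    and x y :: "real \<Rightarrow> real \<Rightarrow> real"
    and F G :: "real^'v \<Rightarrow> real^'v"
    and \<alpha> :: "real \<times> real \<Rightarrow> real^'v \<Rightarrow> real^'v \<Rightarrow> real"
  assumes "l \<ge> 1"
    and "x \<in> tensor_poly l l" and "y \<in> tensor_poly l l"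
    and "\<forall>\<xi>\<in>{-1..1}. \<forall>\<eta>\<in>{-1..1}.
           d_xi x \<xi> \<eta> * d_eta y \<xi> \<eta> - d_eta x \<xi> \<eta> * d_xi y \<xi> \<eta> \<noteq> 0"
  shows "numerically_satisfies_GCL k l x y (nonconservative_metrics x y) F G \<alpha>
       \<and> (\<forall>\<theta> \<tau>. numerically_satisfies_GCL k l x y (conservative_metrics \<theta> \<tau> x y) F G \<alpha>)"
  using nonconservative_GCL[OF assms] conservative_eq_nonconservative[OF assms(2,3)] by simp

end
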